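(* Let $(\Omega,\rho)$ be a Euclidean polynomial space (with inner product $\langle\cdot,\cdot\rangle$ on $\mathrm{Pol}(\Omega)$) of dimension $n$, and let $X\subset\Omega$ be a weighted $t$-design in $(\Omega,\rho)$ with weight function $w:X\to\mathbb{R}_{>0}$. Let $m\ge n$ and let $\tau:\Omega\to\mathbb{R}^m$ be an injection that is affinely compatible with $\rho$. Let $\xi:\mathbb{R}^m\to\mathbb{R}^s$ be an affine map (not necessarily injective, not necessarily related to $\rho$). Then for each $f\in\mathbb{R}_t[x_1,\ldots,x_s]$ we have $f\circ\xi\circ\tau\in\mathrm{Pol}(\Omega,t)$ and \[ \langle 1, f\circ\xi\circ\tau\rangle=\sum_{x\in X}w(x)\,f(\xi(\tau(x))). \]
   Context: Let $\Omega$ be a nonempty set and $\rho:\Omega\times\Omega\to\mathbb{R}$ a function (the separation function); for $a\in\Omega$ write $\rho_a(\eta)=\rho(a,\eta)$. Let $\mathrm{Pol}(\Omega,0)$ be the space of constant real functions on $\Omega$, $\mathrm{Pol}(\Omega,1)=\mathrm{Span}_{\mathbb{R}}\{f\circ\rho_a : a\in\Omega,\ f\in\mathbb{R}[x],\ \deg f\le 1\}$, and inductively $\mathrm{Pol}(\Omega,r+1)=\mathrm{Span}_{\mathbb{R}}\{gh : g\in\mathrm{Pol}(\Omega,r),\ h\in\mathrm{Pol}(\Omega,1)\}$; $\mathrm{Pol}(\Omega)=\bigcup_{r\ge0}\mathrm{Pol}(\Omega,r)$. $(\Omega,\rho)$ together with an inner product $\langle\cdot,\cdot\rangle$ on $\mathrm{Pol}(\Omega)$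 is a polynomial space if: (i) $\rho(x,y)=\rho(y,x)$ for all $x,y$; (ii) each $\mathrm{Pol}(\Omega,r)$ is finite-dimensional; (iii) $\langle f,g\rangle=\langle 1,fg\rangle$ for all $f,g\in\mathrm{Pol}(\Omega)$; (iv) if $f\in\mathrm{Pol}(\Omega)$ satisfies $f(x)\ge0$ for all $x$, then $\langle 1,f\rangle\ge 0$, with equality iff $f=0$. We normalize $\langle1,1\rangle=1$. The dimension of the polynomial space is $\dim\mathrm{Pol}(\Omega,1)-1$. Two separation functions $\rho,\sigma$ are affinely equivalent if $\rho=a\sigma+b$ for some $a\in\mathbb{R}\setminus\{0\}$, $b\in\mathbb{R}$. The polynomial space is Euclidean if there exist an integer $d$, an injection $\tau_0:\Omega\to\mathbb{R}^d$ and a separation function $\rho'$ affinely equivalent to $\rho$ with $\rho'(x,y)=(\tau_0(x),\tau_0(y))$ for all $x,y$, where $(\cdot,\cdot)$ is the standard inner product. An injection $\tau:\Omega\to\mathbb{R}^m$ is affinely compatible with $\rho$ if there exist $a\in\mathbb{R}\setminus\{0\}$, $b\in\mathbb{R}$ with $\rho(x,y)=a(\tau(x),\tau(y))+b$ for all $x,y\in\Omega$. A weighted $t$-design is a finite subset $X\subset\Omega$ with a weight function $w:X\to\mathbb{R}_{>0}$ such that $\langle 1,f\rangle=\sum_{x\in X}w(x)f(x)$ for all $f\in\mathrm{Pol}(\Omega,t)$. $\mathbb{R}_t[x_1,\ldots,x_s]$ is the space of real polynomials of total degree at most $t$. *)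

theory Defs
  imports
    "Jordan_Normal_Form.Matrix"
    "HOL-Library.Function_Algebras"
    "HOL-Library.Poly_Mapping"
    "HOL-Computational_Algebra.Polynomial"
begin

text \<open>The set \<open>\<Omega>\<close> is the (nonempty) type \<open>'a\<close>. Sums, products, \<open>0\<close> and \<open>1\<close> of real functions
  on it are pointwise. The space \<open>\<real>\<^sup>d\<close> is \<open>carrier_vec d :: real vec set\<close>, with \<open>\<bullet>\<close> the
  standard inner product.\<close>

interpretation real_fun: vector_space "\<lambda>(c::real) (f::'a \<Rightarrow> real) x. c * f x"
  by unfold_locales (auto simp: fun_eq_iff algebra_simps)

fun Pol :: "('a \<Rightarrow> 'a \<Rightarrow> real) \<Rightarrow> nat \<Rightarrow> ('a \<Rightarrow> real) set" where
  "Pol \<rho> 0 = range (\<lambda>c x. c)"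
| "Pol \<rho> (Suc 0) = real_fun.span {poly f \<circ> \<rho> a | f a. degree f \<le> 1}"
| "Pol \<rho> (Suc (Suc r)) = real_fun.span {g * h | g h. g \<in> Pol \<rho> (Suc r) \<and> h \<in> Pol \<rho> (Suc 0)}"

definition Pol_all :: "('a \<Rightarrow> 'a \<Rightarrow> real) \<Rightarrow> ('a \<Rightarrow> real) set" where
  "Pol_all \<rho> = (\<Union>r. Pol \<rho> r)"

definition inner_product_on ::
    "('a \<Rightarrow> real) set \<Rightarrow> (('a \<Rightarrow> real) \<Rightarrow> ('a \<Rightarrow> real) \<Rightarrow> real) \<Rightarrow> bool" where
  "inner_product_on V ip \<longleftrightarrow>
     (\<forall>f\<in>V. \<forall>g\<in>V. ip f g = ip g f) \<and>
     (\<forall>f\<in>V. \<forall>g\<in>V. \<forall>h\<in>V. ip (f + g) h = ip f h + ip g h) \<and>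
     (\<forall>c. \<forall>f\<in>V. \<forall>g\<in>V. ip (\<lambda>x. c * f x) g = c * ip f g) \<and>
     (\<forall>f\<in>V. 0 \<le> ip f f \<and> (ip f f = 0 \<longleftrightarrow> f = 0))"

locale polynomial_space =
  fixes \<rho> :: "'a \<Rightarrow> 'a \<Rightarrow> real"
    and ip :: "('a \<Rightarrow> real) \<Rightarrow> ('a \<Rightarrow> real) \<Rightarrow> real"
  assumes inner_product: "inner_product_on (Pol_all \<rho>) ip"
    and symmetric: "\<rho> x y = \<rho> y x"
    and finite_dim: "\<exists>B. finite B \<and> Pol \<rho> r = real_fun.span B"
    and ip_mult: "f \<in> Pol_all \<rho> \<Longrightarrow> g \<in> Pol_all \<rho> \<Longrightarrow> ip f g = ip 1 (f * g)"
    and ip_nonneg: "f \<in> Pol_all \<rho> \<Longrightarrow> (\<And>x. 0 \<le> f x) \<Longrightarrow> 0 \<le> ip 1 f"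
    and ip_eq_0_iff: "f \<in> Pol_all \<rho> \<Longrightarrow> (\<And>x. 0 \<le> f x) \<Longrightarrow> ip 1 f = 0 \<longleftrightarrow> f = 0"
    and normalized: "ip 1 1 = 1"

text \<open>The subtraction does not truncate: \<open>Pol \<rho> 1\<close> contains the constant \<open>1\<close>.\<close>

definition polynomial_space_dim :: "('a \<Rightarrow> 'a \<Rightarrow> real) \<Rightarrow> nat" where
  "polynomial_space_dim \<rho> = real_fun.dim (Pol \<rho> 1) - 1"

definition affinely_equivalent :: "('a \<Rightarrow> 'a \<Rightarrow> real) \<Rightarrow> ('a \<Rightarrow> 'a \<Rightarrow> real) \<Rightarrow> bool" where
  "affinely_equivalent \<rho> \<sigma> \<longleftrightarrow> (\<exists>a b. a \<noteq> 0 \<and> (\<forall>x y. \<rho> x y = a * \<sigma> x y + b))"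

definition euclidean_polynomial_space ::
    "('a \<Rightarrow> 'a \<Rightarrow> real) \<Rightarrow> (('a \<Rightarrow> real) \<Rightarrow> ('a \<Rightarrow> real) \<Rightarrow> real) \<Rightarrow> bool" where
  "euclidean_polynomial_space \<rho> ip \<longleftrightarrow>
     polynomial_space \<rho> ip \<and>
     (\<exists>d \<tau>\<^sub>0 \<rho>'. range \<tau>\<^sub>0 \<subseteq> carrier_vec d \<and> inj \<tau>\<^sub>0 \<and> affinely_equivalent \<rho>' \<rho> \<and>
        (\<forall>x y. \<rho>' x y = \<tau>\<^sub>0 x \<bullet> \<tau>\<^sub>0 y))"

definition affinely_compatible ::
    "nat \<Rightarrow> ('a \<Rightarrow> real vec) \<Rightarrow> ('a \<Rightarrow> 'a \<Rightarrow> real) \<Rightarrow> bool" where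
  "affinely_compatible m \<tau> \<rho> \<longleftrightarrow>
     range \<tau> \<subseteq> carrier_vec m \<and> inj \<tau> \<and>
     (\<exists>a b. a \<noteq> 0 \<and> (\<forall>x y. \<rho> x y = a * (\<tau> x \<bullet> \<tau> y) + b))"

definition weighted_design ::
    "('a \<Rightarrow> 'a \<Rightarrow> real) \<Rightarrow> (('a \<Rightarrow> real) \<Rightarrow> ('a \<Rightarrow> real) \<Rightarrow> real) \<Rightarrow> nat \<Rightarrow> 'a set \<Rightarrow> ('a \<Rightarrow> real) \<Rightarrow> bool"
  where
  "weighted_design \<rho> ip t X w \<longleftrightarrow>
     finite X \<and> (\<forall>x\<in>X. 0 < w x) \<and> (\<forall>f\<in>Pol \<rho> t. ip 1 f = (\<Sum>x\<in>X. w x * f x))"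

definition affine_map :: "nat \<Rightarrow> nat \<Rightarrow> (real vec \<Rightarrow> real vec) \<Rightarrow> bool" where
  "affine_map m s \<xi> \<longleftrightarrow>
     (\<exists>A\<in>carrier_mat s m. \<exists>c\<in>carrier_vec s. \<forall>v\<in>carrier_vec m. \<xi> v = A *\<^sub>v v + c)"

text \<open>A multivariate polynomial maps finitely many monomials, given as exponent functions
  \<open>nat \<Rightarrow>\<^sub>0 nat\<close>, to nonzero coefficients. The variables \<open>x\<^sub>1, \<dots>, x\<^sub>s\<close> are indexed
  by \<open>0, \<dots>, s - 1\<close>.\<close>

type_synonym real_mpoly = "(nat \<Rightarrow>\<^sub>0 nat) \<Rightarrow>\<^sub>0 real"

definition mpoly_eval :: "real_mpoly \<Rightarrow> real vec \<Rightarrow> real" where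
  "mpoly_eval p v =
     (\<Sum>\<alpha>\<in>Poly_Mapping.keys p.
        Poly_Mapping.lookup p \<alpha> *
        (\<Prod>i\<in>Poly_Mapping.keys \<alpha>. (v $ i) ^ Poly_Mapping.lookup \<alpha> i))"

definition mpolys_upto :: "nat \<Rightarrow> nat \<Rightarrow> real_mpoly set" where
  "mpolys_upto s t =
     {p. \<forall>\<alpha>\<in>Poly_Mapping.keys p.
           Poly_Mapping.keys \<alpha> \<subseteq> {..<s} \<and>
           (\<Sum>i\<in>Poly_Mapping.keys \<alpha>. Poly_Mapping.lookup \<alpha> i) \<le> t}"

end

theory Submission
  imports Defs
begin

text \<open>For \<open>u \<in> \<real>\<^sup>m\<close> the function \<open>x \<mapsto> u \<bullet> \<tau> x\<close> only depends on the orthogonal projection of \<open>u\<close>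
  onto the span of the image of \<open>\<tau>\<close>. That projection is a combination of vectors \<open>\<tau> a\<close>, and
  \<open>\<tau> a \<bullet> \<tau> x\<close> is an affine function of \<open>\<rho> a x\<close>, so \<open>x \<mapsto> u \<bullet> \<tau> x\<close> lies in \<open>Pol \<rho> 1\<close>. Hence so do the
  coordinates of \<open>\<xi> \<circ> \<tau>\<close>, and a polynomial of degree at most \<open>t\<close> in them lies in \<open>Pol \<rho> t\<close>, where the
  design property applies.\<close>

section \<open>Orthogonal projection onto a span in R^m\<close>

text \<open>Gram-Schmidt, with \<open>u\<close> generalized so that the induction hypothesis
  projects both \<open>u\<close> and the new vector \<open>b\<close> onto the span of
  \<open>B\<close>. The remainder \<open>b'\<close> of \<open>b\<close> is orthogonal to
  \<open>B\<close>, so correcting the projection \<open>q\<close> of \<open>u\<close> along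
  \<open>b'\<close> keeps orthogonality to \<open>B\<close>. Vectors are functions on
  \<open>nat\<close> in order to use the vector space \<open>real_fun\<close>; only the indices
  below \<open>m\<close> enter the form.\<close>

lemma orthogonal_decomposition_finite:
  fixes B :: "(nat \<Rightarrow> real) set" and u :: "nat \<Rightarrow> real"
  assumes "finite B"
  shows "\<exists>v\<in>real_fun.span B. \<forall>b\<in>B. (\<Sum>i<m. (u i - v i) * b i) = 0"
  using assms
proof (induction B arbitrary: u rule: finite_induct)
  case empty
  then show ?case using real_fun.span_zero by blast
next
  case (insert b B)
  define d where "d = (\<lambda>f g :: nat \<Rightarrow> real. \<Sum>i<m. f i * g i)"
  have d_add: "d (\<lambda>i. f i + g i) h = d f h + d g h" for f g h
    by (simp add: d_def sum.distrib algebra_simps)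
  have d_diff: "d (\<lambda>i. f i - g i) h = d f h - d g h" for f g h
    by (simp add: d_def sum_subtractf algebra_simps)
  have d_scale: "d (\<lambda>i. c * f i) g = c * d f g" for c f g
    by (simp add: d_def sum_distrib_left algebra_simps)
  have d_commute: "d f g = d g f" for f g
    by (simp add: d_def mult.commute)
  obtain p where p: "p \<in> real_fun.span B" "\<And>c. c \<in> B \<Longrightarrow> d (\<lambda>i. b i - p i) c = 0"
    using insert.IH[of b] unfolding d_def by blast
  obtain q where q: "q \<in> real_fun.span B" "\<And>c. c \<in> B \<Longrightarrow> d (\<lambda>i. u i - q i) c = 0"
    using insert.IH[of u] unfolding d_def by blast
  have perp_span: "d r f = 0" if "\<And>c. c \<in> B \<Longrightarrow> d r c = 0" "f \<in> real_fun.span B" for r f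
    using that(2)
  proof (induction rule: real_fun.span_induct_alt)
    case base
    then show ?case by (simp add: d_def)
  next
    case (step k x y)
    then show ?case
      using that(1) by (simp only: d_commute[of r] plus_fun_def d_add d_scale)
  qed
  define b' where "b' = (\<lambda>i. b i - p i)"
  \<comment> \<open>The coefficient that makes \<open>u - v\<close> orthogonal to \<open>b'\<close>.
    If \<open>d b' b' = 0\<close>, division by zero gives \<open>k = 0\<close>, which is harmless:
    \<open>b'\<close> then vanishes at all indices below \<open>m\<close>.\<close>
  define k where "k = d (\<lambda>i. u i - q i) b' / d b' b'"
  define v where "v = (\<lambda>i. q i + k * b' i)"
  have sub: "real_fun.span B \<subseteq> real_fun.span (insert b B)"
    by (rule real_fun.span_mono) auto
  have "b' = b - p" by (simp add: b'_def fun_eq_iff)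
  then have "b' \<in> real_fun.span (insert b B)"
    using p(1) sub by (auto intro: real_fun.span_diff real_fun.span_base)
  moreover have "v = q + (\<lambda>i. k * b' i)" by (simp add: v_def fun_eq_iff)
  ultimately have v: "v \<in> real_fun.span (insert b B)"
    using q(1) sub by (auto intro: real_fun.span_add real_fun.span_scale)
  have b'B: "d b' c = 0" if "c \<in> B" for c
    using p(2) that by (simp add: b'_def)
  have uv: "d (\<lambda>i. u i - v i) g = d (\<lambda>i. u i - q i) g - k * d b' g" for g
  proof -
    have "(\<lambda>i. u i - v i) = (\<lambda>i. (u i - q i) - k * b' i)" by (simp add: v_def algebra_simps)
    then show ?thesis by (simp only: d_diff d_scale)
  qed
  have perpB: "d (\<lambda>i. u i - v i) c = 0" if "c \<in> B" for c
    using uv q(2) b'B that by simp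
  have "d (\<lambda>i. u i - v i) b' = 0"
  proof (cases "d b' b' = 0")
    case True
    then have "\<forall>i<m. b' i = 0"
      unfolding d_def by (subst (asm) sum_nonneg_eq_0_iff) auto
    then show ?thesis by (simp add: d_def)
  next
    case False
    then show ?thesis by (simp add: uv k_def)
  qed
  moreover have "d (\<lambda>i. u i - v i) p = 0"
    using perp_span perpB p(1) by blast
  \<comment> \<open>Here \<open>b = b' + p\<close>, and both summands are orthogonal to
    \<open>u - v\<close>.\<close>
  ultimately have "d (\<lambda>i. u i - v i) b = 0"
    using d_diff[of b p "\<lambda>i. u i - v i"] by (simp add: d_commute b'_def)
  then show ?case using v perpB unfolding d_def by blast
qed

text \<open>An infinite \<open>S\<close> reduces to a maximal independent subset \<open>B\<close>.
  The support condition places \<open>S\<close> in the span of \<open>m\<close> unit functions, so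
  \<open>B\<close> is finite, and orthogonality to \<open>B\<close> extends linearly to its span,
  which contains \<open>S\<close>.\<close>

lemma orthogonal_decomposition:
  fixes S :: "(nat \<Rightarrow> real) set" and u :: "nat \<Rightarrow> real"
  assumes supp: "\<And>f i. f \<in> S \<Longrightarrow> m \<le> i \<Longrightarrow> f i = 0"
  shows "\<exists>v\<in>real_fun.span S. \<forall>f\<in>S. (\<Sum>i<m. (u i - v i) * f i) = 0"
proof -
  obtain B where B: "B \<subseteq> S" "real_fun.independent B" "S \<subseteq> real_fun.span B"
    using real_fun.maximal_independent_subset by blast
  define e :: "nat \<Rightarrow> nat \<Rightarrow> real" where "e = (\<lambda>j i. if i = j then 1 else 0)"
  have "S \<subseteq> real_fun.span (e ` {..<m})"
  proof
    fix f assume "f \<in> S"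
    have "f i = (\<Sum>j<m. (\<lambda>i. f j * e j i)) i" for i
    proof -
      have "(\<Sum>j<m. (\<lambda>i. f j * e j i)) i = (\<Sum>j<m. f j * e j i)"
        by (induction m) auto
      also have "\<dots> = (\<Sum>j<m. if i = j then f j else 0)"
        by (rule sum.cong) (auto simp: e_def)
      also have "\<dots> = f i"
        using supp[OF \<open>f \<in> S\<close>, of i] by (simp add: sum.delta')
      finally show ?thesis by simp
    qed
    then have "f = (\<Sum>j<m. (\<lambda>i. f j * e j i))" by blast
    also have "\<dots> \<in> real_fun.span (e ` {..<m})"
      by (intro real_fun.span_sum real_fun.span_scale real_fun.span_base) auto
    finally show "f \<in> real_fun.span (e ` {..<m})" .
  qed
  then have "finite B"
    using real_fun.independent_span_bound[of "e ` {..<m}" B] B by auto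
  then obtain v where v: "v \<in> real_fun.span B" "\<And>b. b \<in> B \<Longrightarrow> (\<Sum>i<m. (u i - v i) * b i) = 0"
    using orthogonal_decomposition_finite[of B u m] by blast
  have "(\<Sum>i<m. (u i - v i) * f i) = 0" if "f \<in> real_fun.span B" for f
    using that
  proof (induction rule: real_fun.span_induct_alt)
    case base
    then show ?case by simp
  next
    case (step k x y)
    have "(\<Sum>i<m. (u i - v i) * ((\<lambda>i. k * x i) + y) i)
        = k * (\<Sum>i<m. (u i - v i) * x i) + (\<Sum>i<m. (u i - v i) * y i)"
      by (simp add: sum_distrib_left flip: sum.distrib) (simp add: algebra_simps)
    then show ?case using step v(2) by simp
  qed
  moreover have "v \<in> real_fun.span S"
    using v(1) B(1) real_fun.span_mono by blast
  ultimately show ?thesis using B(3) by blast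
qed

section \<open>Closure properties of the spaces \<open>Pol \<rho> r\<close>\<close>

lemma subspace_Pol: "real_fun.subspace (Pol \<rho> r)"
proof (induction \<rho> r rule: Pol.induct)
  case (1 \<rho>)
  then show ?case
    by (auto simp: real_fun.subspace_def fun_eq_iff image_def)
qed (simp_all only: Pol.simps real_fun.subspace_span)

lemma const_in_Pol_1: "(\<lambda>x. c) \<in> Pol \<rho> (Suc 0)"
proof -
  have "poly [:c:] \<circ> \<rho> a \<in> {poly f \<circ> \<rho> a | f a. degree f \<le> 1}" for a
    by (intro CollectI exI[of _ "[:c:]"] exI[of _ a] conjI refl) simp
  then show ?thesis by (auto simp: comp_def intro: real_fun.span_base)
qed

text \<open>The case \<open>r = 0\<close> is separate because \<open>Pol \<rho> 1\<close> is not
  defined through products; there \<open>g\<close> is constant and merely scales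
  \<open>h\<close>.\<close>

lemma Pol_mult_Pol_1:
  assumes "g \<in> Pol \<rho> r" "h \<in> Pol \<rho> (Suc 0)"
  shows "(\<lambda>x. g x * h x) \<in> Pol \<rho> (Suc r)"
proof (cases r)
  case 0
  with assms(1) obtain c where "g = (\<lambda>x. c)" by auto
  then show ?thesis
    using 0 real_fun.subspace_scale[OF subspace_Pol assms(2), of c] by simp
next
  case (Suc k)
  have "(\<lambda>x. g x * h x) = g * h" by (simp add: fun_eq_iff)
  then show ?thesis using assms Suc by (auto intro!: real_fun.span_base)
qed

text \<open>Multiplication by the constant 1, an element of \<open>Pol \<rho> 1\<close>, raises the
  index by one.\<close>

lemma Pol_mono:
  assumes "r \<le> r'"
  shows "Pol \<rho> r \<subseteq> Pol \<rho> r'"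
  using assms
proof (induction rule: dec_induct)
  case base
  then show ?case by simp
next
  case (step k)
  have "g \<in> Pol \<rho> (Suc k)" if "g \<in> Pol \<rho> k" for g
    using Pol_mult_Pol_1[OF that const_in_Pol_1[of 1]] by simp
  then show ?case using step by blast
qed

lemma Pol_mult_power:
  assumes "g \<in> Pol \<rho> r" "h \<in> Pol \<rho> (Suc 0)"
  shows "(\<lambda>x. g x * h x ^ k) \<in> Pol \<rho> (r + k)"
proof (induction k)
  case 0
  then show ?case using assms by simp
next
  case (Suc k)
  then show ?case
    using Pol_mult_Pol_1[OF Suc assms(2)] by (simp add: algebra_simps)
qed

lemma Pol_monomial:
  assumes "finite I" "\<And>i. i \<in> I \<Longrightarrow> h i \<in> Pol \<rho> (Suc 0)"
  shows "(\<lambda>x. \<Prod>i\<in>I. h i x ^ e i) \<in> Pol \<rho> (\<Sum>i\<in>I. e i)"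
  using assms
proof (induction I rule: finite_induct)
  case empty
  then show ?case by auto
next
  case (insert i I)
  then have "(\<lambda>x. (\<Prod>i\<in>I. h i x ^ e i) * h i x ^ e i) \<in> Pol \<rho> ((\<Sum>i\<in>I. e i) + e i)"
    by (intro Pol_mult_power) auto
  then show ?case using insert by (simp add: algebra_simps)
qed

lemma Pol_sum:
  assumes "\<And>i. i \<in> I \<Longrightarrow> h i \<in> Pol \<rho> r"
  shows "(\<lambda>x. \<Sum>i\<in>I. c i * h i x) \<in> Pol \<rho> r"
proof -
  have "(\<Sum>i\<in>I. (\<lambda>x. c i * h i x)) \<in> Pol \<rho> r"
    by (intro real_fun.subspace_sum[OF subspace_Pol] real_fun.subspace_scale[OF subspace_Pol] assms)
  moreover have "(\<Sum>i\<in>I. (\<lambda>x. c i * h i x)) = (\<lambda>x. \<Sum>i\<in>I. c i * h i x)"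
    by (induction I rule: infinite_finite_induct) (auto simp: fun_eq_iff)
  ultimately show ?thesis by simp
qed

text \<open>Each monomial lies in the space indexed by its own degree, and monotonicity lifts it to
  \<open>t\<close> before the sum is taken.\<close>

lemma mpoly_eval_in_Pol:
  assumes "f \<in> mpolys_upto s t"
    and "\<And>i. i < s \<Longrightarrow> (\<lambda>x. \<phi> x $ i) \<in> Pol \<rho> (Suc 0)"
  shows "(\<lambda>x. mpoly_eval f (\<phi> x)) \<in> Pol \<rho> t"
  unfolding mpoly_eval_def
proof (rule Pol_sum)
  fix \<alpha> assume "\<alpha> \<in> Poly_Mapping.keys f"
  then have "Poly_Mapping.keys \<alpha> \<subseteq> {..<s}"
    and deg: "(\<Sum>i\<in>Poly_Mapping.keys \<alpha>. Poly_Mapping.lookup \<alpha> i) \<le> t"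
    using assms(1) by (auto simp: mpolys_upto_def)
  then have "(\<lambda>x. \<Prod>i\<in>Poly_Mapping.keys \<alpha>. \<phi> x $ i ^ Poly_Mapping.lookup \<alpha> i)
      \<in> Pol \<rho> (\<Sum>i\<in>Poly_Mapping.keys \<alpha>. Poly_Mapping.lookup \<alpha> i)"
    using assms(2) by (intro Pol_monomial) auto
  then show "(\<lambda>x. \<Prod>i\<in>Poly_Mapping.keys \<alpha>. \<phi> x $ i ^ Poly_Mapping.lookup \<alpha> i) \<in> Pol \<rho> t"
    using Pol_mono[OF deg] by blast
qed

section \<open>Affine functions of \<open>\<tau>\<close> as elements of
  \<open>Pol \<rho> 1\<close>\<close>

lemma linear_functional_in_Pol_1:
  assumes "affinely_compatible m \<tau> \<rho>" and u: "u \<in> carrier_vec m"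
  shows "(\<lambda>x. u \<bullet> \<tau> x) \<in> Pol \<rho> (Suc 0)"
proof -
  from assms(1) obtain a b where \<tau>: "\<And>x. \<tau> x \<in> carrier_vec m" and "a \<noteq> 0"
    and \<rho>: "\<And>x y. \<rho> x y = a * (\<tau> x \<bullet> \<tau> y) + b"
    unfolding affinely_compatible_def by blast
  \<comment> \<open>Padding with zeros beyond \<open>m\<close> turns the vectors into functions that
    meet the support condition of \<open>orthogonal_decomposition\<close>.\<close>
  define T where "T = (\<lambda>x i. if i < m then \<tau> x $ i else 0)"
  have sp: "v \<bullet> \<tau> x = (\<Sum>i<m. v $ i * T x i)" for v x
    using \<tau>[of x] by (simp add: scalar_prod_def T_def atLeast0LessThan)
  have "\<exists>v\<in>real_fun.span (range T). \<forall>f\<in>range T. (\<Sum>i<m. (u $ i - v i) * f i) = 0"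
    by (rule orthogonal_decomposition) (auto simp: T_def)
  then obtain v where v: "v \<in> real_fun.span (range T)"
    and perp: "\<And>x. (\<Sum>i<m. (u $ i - v i) * T x i) = 0"
    by blast
  have "(\<lambda>x. \<Sum>i<m. v i * T x i) \<in> Pol \<rho> (Suc 0)"
    using v
  proof (induction rule: real_fun.span_induct_alt)
    case base
    then show ?case using const_in_Pol_1[of 0] by simp
  next
    case (step k g y)
    then obtain z where z: "g = T z" by blast
    \<comment> \<open>By linearity in \<open>v\<close>, generators \<open>T z\<close> suffice. The
      polynomial inverts the affine relation: the inner product of \<open>\<tau> z\<close> and
      \<open>\<tau> x\<close> is \<open>(\<rho> z x - b) / a\<close>.\<close>
    have "(\<Sum>i<m. g i * T x i) = poly [:- b / a, 1 / a:] (\<rho> z x)" for x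
    proof -
      have "(\<Sum>i<m. g i * T x i) = \<tau> z \<bullet> \<tau> x"
        unfolding sp z by (rule sum.cong) (auto simp: T_def)
      then show ?thesis using \<open>a \<noteq> 0\<close> by (simp add: \<rho> field_simps)
    qed
    then have "(\<lambda>x. \<Sum>i<m. g i * T x i) = poly [:- b / a, 1 / a:] \<circ> \<rho> z"
      by (simp add: fun_eq_iff)
    moreover have "degree [:- b / a, 1 / a:] \<le> 1" by simp
    ultimately have "(\<lambda>x. \<Sum>i<m. g i * T x i) \<in> Pol \<rho> (Suc 0)"
      unfolding Pol.simps by (intro real_fun.span_base) blast
    then have "(\<lambda>x. k * (\<Sum>i<m. g i * T x i)) + (\<lambda>x. \<Sum>i<m. y i * T x i) \<in> Pol \<rho> (Suc 0)"
      using step by (intro real_fun.subspace_add[OF subspace_Pol]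
          real_fun.subspace_scale[OF subspace_Pol])
    moreover have "(\<lambda>x. k * (\<Sum>i<m. g i * T x i)) + (\<lambda>x. \<Sum>i<m. y i * T x i)
        = (\<lambda>x. \<Sum>i<m. ((\<lambda>i. k * g i) + y) i * T x i)"
      by (simp add: fun_eq_iff sum_distrib_left sum.distrib algebra_simps)
    ultimately show ?case by simp
  qed
  \<comment> \<open>The difference of \<open>u\<close> and \<open>v\<close> is orthogonal to every
    \<open>T x\<close>, so both induce the same function of \<open>x\<close>.\<close>
  moreover have "u \<bullet> \<tau> x = (\<Sum>i<m. v i * T x i)" for x
    using perp[of x] unfolding sp by (simp add: algebra_simps sum_subtractf)
  ultimately show ?thesis by simp
qed

text \<open>A coordinate of an affine map is the inner product with a row of its matrix plus a
  constant.\<close>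

lemma affine_coordinate_in_Pol_1:
  assumes "affinely_compatible m \<tau> \<rho>" "affine_map m s \<xi>" "i < s"
  shows "(\<lambda>x. \<xi> (\<tau> x) $ i) \<in> Pol \<rho> (Suc 0)"
proof -
  from assms(2) obtain A c where A: "A \<in> carrier_mat s m" and c: "c \<in> carrier_vec s"
    and \<xi>: "\<And>v. v \<in> carrier_vec m \<Longrightarrow> \<xi> v = A *\<^sub>v v + c"
    unfolding affine_map_def by blast
  have \<tau>: "\<tau> x \<in> carrier_vec m" for x
    using assms(1) unfolding affinely_compatible_def by blast
  have "row A i \<in> carrier_vec m" using A by auto
  then have "(\<lambda>x. row A i \<bullet> \<tau> x) + (\<lambda>x. c $ i) \<in> Pol \<rho> (Suc 0)"
    by (intro real_fun.subspace_add[OF subspace_Pol] const_in_Pol_1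
        linear_functional_in_Pol_1[OF assms(1)])
  moreover have "\<xi> (\<tau> x) $ i = row A i \<bullet> \<tau> x + c $ i" for x
    using A c \<xi>[OF \<tau>] assms(3) by simp
  ultimately show ?thesis by (simp add: plus_fun_def)
qed

theorem theorem3p6:
  fixes \<rho> :: "'a \<Rightarrow> 'a \<Rightarrow> real"
    and ip :: "('a \<Rightarrow> real) \<Rightarrow> ('a \<Rightarrow> real) \<Rightarrow> real"
    and n m s t :: nat
    and X :: "'a set" and w :: "'a \<Rightarrow> real"
    and \<tau> :: "'a \<Rightarrow> real vec" and \<xi> :: "real vec \<Rightarrow> real vec"
  assumes "euclidean_polynomial_space \<rho> ip"
    and "polynomial_space_dim \<rho> = n"
    and "weighted_design \<rho> ip t X w"
    and "m \<ge> n"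
    and "affinely_compatible m \<tau> \<rho>"
    and "affine_map m s \<xi>"
  shows "\<forall>f \<in> mpolys_upto s t.
           mpoly_eval f \<circ> \<xi> \<circ> \<tau> \<in> Pol \<rho> t \<and>
           ip 1 (mpoly_eval f \<circ> \<xi> \<circ> \<tau>) = (\<Sum>x\<in>X. w x * mpoly_eval f (\<xi> (\<tau> x)))"
proof
  fix f assume f: "f \<in> mpolys_upto s t"
  have "(\<lambda>x. mpoly_eval f (\<xi> (\<tau> x))) \<in> Pol \<rho> t"
    by (intro mpoly_eval_in_Pol[OF f] affine_coordinate_in_Pol_1[OF assms(5,6)])
  then have "mpoly_eval f \<circ> \<xi> \<circ> \<tau> \<in> Pol \<rho> t" by (simp add: comp_def)
  then show "mpoly_eval f \<circ> \<xi> \<circ> \<tau> \<in> Pol \<rho> t \<and>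
      ip 1 (mpoly_eval f \<circ> \<xi> \<circ> \<tau>) = (\<Sum>x\<in>X. w x * mpoly_eval f (\<xi> (\<tau> x)))"
    using assms(3) by (simp add: weighted_design_def)
qed

end
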